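(* Let $\gamma>2$ and let $F:\mathcal S_N\to\mathbb R$ be a continuous, uniformly elliptic, rotationally invariant and positively $1$-homogeneous operator (see context). Define $$\bar\lambda'_\gamma=\sup\Big\{\mu:\ \exists\,u\in C^2(B(0,1)\setminus\{0\}),\ u>0\text{ in }B(0,1)\setminus\{0\},\ u\text{ radial},\ F(D^2u)+\mu\frac{u}{r^\gamma}\le0\text{ in }B(0,1)\setminus\{0\}\Big\}.$$ Then $\bar\lambda'_\gamma=0$.
   Context: $B(0,1)$ is the open unit ball in $\mathbb R^N$, $r=|x|$, and $\mathcal S_N$ is the set of symmetric $N\times N$ matrices. Constants $\Lambda\ge\lambda>0$ are fixed. The operator $F$ is continuous on $\mathcal S_N$ and satisfies: $\lambda\,\mathrm{tr}(M')\le F(M+M')-F(M)\le\Lambda\,\mathrm{tr}(M')$ for all $M,M'\in\mathcal S_N$ with $M'$ positive semidefinite (uniform ellipticity); $F(O^tMO)=F(M)$ for all orthogonal $O$ and all $M\in\mathcal S_N$; $F(tM)=tF(M)$ for all $t>0$, $M\in\mathcal S_N$. Standing assumption: $\tilde N_+>2$, where $\tilde N_+=\frac{\lambda}{\Lambda}(N-1)+1$. *)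

theory Defs
  imports "HOL-Analysis.Analysis"
begin

definition symmetric_matrices :: "(real ^ 'n ^ 'n) set"
  where "symmetric_matrices = {M. transpose M = M}"

definition psd_matrix :: "real ^ 'n ^ 'n \<Rightarrow> bool"
  where "psd_matrix M \<longleftrightarrow> transpose M = M \<and> (\<forall>x. 0 \<le> x \<bullet> (M *v x))"

text \<open>An operator on symmetric matrices is a function on all of \<open>real ^ 'n ^ 'n\<close>;
  every condition below constrains it on symmetric matrices only.\<close>

definition uniformly_elliptic :: "real \<Rightarrow> real \<Rightarrow> (real ^ 'n ^ 'n \<Rightarrow> real) \<Rightarrow> bool"
  where "uniformly_elliptic lam Lam F \<longleftrightarrow>
    (\<forall>M\<in>symmetric_matrices. \<forall>M'. psd_matrix M' \<longrightarrow>
      lam * trace M' \<le> F (M + M') - F M \<and> F (M + M') - F M \<le> Lam * trace M')"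

definition rotation_invariant :: "(real ^ 'n ^ 'n \<Rightarrow> real) \<Rightarrow> bool"
  where "rotation_invariant F \<longleftrightarrow>
    (\<forall>M\<in>symmetric_matrices. \<forall>Q. orthogonal_matrix Q \<longrightarrow> F (transpose Q ** M ** Q) = F M)"

definition positively_homogeneous :: "(real ^ 'n ^ 'n \<Rightarrow> real) \<Rightarrow> bool"
  where "positively_homogeneous F \<longleftrightarrow>
    (\<forall>M\<in>symmetric_matrices. \<forall>t>0. F (t *\<^sub>R M) = t * F M)"

definition N_tilde_plus :: "real \<Rightarrow> real \<Rightarrow> nat \<Rightarrow> real"
  where "N_tilde_plus lam Lam N = lam / Lam * (real N - 1) + 1"

definition gradient :: "(real ^ 'n \<Rightarrow> real) \<Rightarrow> real ^ 'n \<Rightarrow> real ^ 'n"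
  where "gradient u x = (THE D. GDERIV u x :> D)"

definition hessian :: "(real ^ 'n \<Rightarrow> real) \<Rightarrow> real ^ 'n \<Rightarrow> real ^ 'n ^ 'n"
  where "hessian u x = matrix (frechet_derivative (gradient u) (at x))"

text \<open>For open \<open>S\<close> this is the class \<open>C\<^sup>2(S)\<close>: differentiability of the gradient
  already makes the gradient continuous.\<close>

definition C2_on :: "(real ^ 'n) set \<Rightarrow> (real ^ 'n \<Rightarrow> real) \<Rightarrow> bool"
  where "C2_on S u \<longleftrightarrow>
    (\<forall>x\<in>S. u differentiable (at x) \<and> gradient u differentiable (at x)) \<and>
    continuous_on S (hessian u)"

lemma gradient_eqI: "GDERIV u x :> D \<Longrightarrow> gradient u x = D"
  unfolding gradient_def
proof (rule the_equality)
  fix E assume "GDERIV u x :> D" "GDERIV u x :> E"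
  then have "(\<lambda>h. h \<bullet> D) = (\<lambda>h. h \<bullet> E)"
    unfolding gderiv_def by (rule has_derivative_unique)
  then have "h \<bullet> D = h \<bullet> E" for h
    by (rule fun_cong)
  then show "E = D"
    using vector_eq_ldot[of E D] by (simp add: inner_commute)
qed

lemma hessian_eqI: "(gradient u has_derivative (*v) H) (at x) \<Longrightarrow> hessian u x = H"
  unfolding hessian_def by (simp flip: frechet_derivative_at)

definition punctured_ball :: "(real ^ 'n) set"
  where "punctured_ball = ball 0 1 - {0}"

definition radial_on :: "(real ^ 'n) set \<Rightarrow> (real ^ 'n \<Rightarrow> real) \<Rightarrow> bool"
  where "radial_on S u \<longleftrightarrow> (\<exists>f :: real \<Rightarrow> real. \<forall>x\<in>S. u x = f (norm x))"

definition positive_radial_supersolution ::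
    "(real ^ 'n ^ 'n \<Rightarrow> real) \<Rightarrow> real \<Rightarrow> real \<Rightarrow> (real ^ 'n \<Rightarrow> real) \<Rightarrow> bool"
  where "positive_radial_supersolution F \<gamma> \<mu> u \<longleftrightarrow>
    C2_on punctured_ball u \<and>
    (\<forall>x\<in>punctured_ball. 0 < u x) \<and>
    radial_on punctured_ball u \<and>
    (\<forall>x\<in>punctured_ball. F (hessian u x) + \<mu> * (u x / norm x powr \<gamma>) \<le> 0)"

text \<open>The supremum is taken in the extended reals, so that a finite value asserts that the
  set of admissible \<open>\<mu>\<close> is nonempty and bounded above.\<close>

definition lambda_bar' :: "(real ^ 'n ^ 'n \<Rightarrow> real) \<Rightarrow> real \<Rightarrow> ereal"
  where "lambda_bar' F \<gamma> = Sup {ereal \<mu> |\<mu>. \<exists>u. positive_radial_supersolution F \<gamma> \<mu> u}"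

end

(* The value mu = 0 is attained by u = 1. For mu > 0 a supersolution u = f(r) satisfies a
   one-dimensional inequality, obtained by comparing F with the minimal Pucci operator on the
   diagonal matrix diag(f'', f'/r, ..., f'/r). If f' >= 0 somewhere, then f is concave and r f'
   nonincreasing to the left of that point (this uses the assumption on N_tilde_plus), so
   f' >= c/r near 0 and f tends to minus infinity at 0. Otherwise f' < 0 throughout, and
   the Riccati variable w = r f'/f satisfies r w' <= -1 near 0 because gamma > 2; hence w
   becomes positive near 0, a contradiction. *)

theory Submission
  imports Defs
begin

section \<open>The one-dimensional differential inequality\<close>

lemma le_of_deriv_nonpos:
  fixes f f' :: "real \<Rightarrow> real"
  assumes "a \<le> b"
    and "\<And>x. a \<le> x \<Longrightarrow> x \<le> b \<Longrightarrow> (f has_real_derivative f' x) (at x)"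
    and "\<And>x. a \<le> x \<Longrightarrow> x \<le> b \<Longrightarrow> f' x \<le> 0"
  shows "f b \<le> f a"
  using assms by (intro DERIV_nonpos_imp_nonincreasing[of a b f]) blast+

text \<open>Here \<open>f\<close> is a radial profile and \<open>n\<close> stands for N - 1. The two
  minima in the last assumption are the minimal Pucci operator on a matrix with eigenvalue f'' once
  and f'/r with multiplicity N - 1. The assumption \<open>Lam < lam * n\<close> is the condition
  \<open>N_tilde_plus\<close> > 2.\<close>

context
  fixes f f1 f2 :: "real \<Rightarrow> real" and lam Lam n \<gamma> \<mu> :: real
  assumes lam: "0 < lam" and Lam: "lam \<le> Lam" and n: "Lam < lam * n"
    and \<gamma>: "2 < \<gamma>" and \<mu>: "0 < \<mu>"
    and f1: "\<And>r. 0 < r \<Longrightarrow> r < 1 \<Longrightarrow> (f has_real_derivative f1 r) (at r)"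
    and f2: "\<And>r. 0 < r \<Longrightarrow> r < 1 \<Longrightarrow> (f1 has_real_derivative f2 r) (at r)"
    and f_pos: "\<And>r. 0 < r \<Longrightarrow> r < 1 \<Longrightarrow> 0 < f r"
    and super: "\<And>r. 0 < r \<Longrightarrow> r < 1 \<Longrightarrow>
      min (lam * f2 r) (Lam * f2 r) + n * min (lam * (f1 r / r)) (Lam * (f1 r / r))
        + \<mu> * (f r / r powr \<gamma>) \<le> 0"
begin

lemma n_pos: "0 < n"
  using lam Lam n by (smt (verit) mult_nonneg_nonpos)

lemma potential_pos:
  assumes "0 < r" "r < 1"
  shows "0 < \<mu> * (f r / r powr \<gamma>)"
  using assms \<mu> f_pos by simp

text \<open>For f' \<ge> 0 the tangential and potential terms are nonnegative, the latter strictly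
  positive, so the radial minimum must be negative. With both signs known the inequality reads Lam
  f'' + lam n f'/r < 0, and lam n > Lam turns it into f'' + f'/r < 0. The second conclusion says
  that r f' has nonpositive derivative.\<close>

lemma concave_where_nondecreasing:
  assumes r: "0 < r" "r < 1" and "0 \<le> f1 r"
  shows "f2 r < 0" and "f1 r + r * f2 r \<le> 0"
proof -
  have q: "0 \<le> f1 r / r"
    using assms by simp
  then have "lam * (f1 r / r) \<le> Lam * (f1 r / r)"
    using Lam by (rule mult_right_mono[rotated])
  then have main: "min (lam * f2 r) (Lam * f2 r) + n * (lam * (f1 r / r)) < 0"
    using super[OF r] potential_pos[OF r] by (simp only: min_absorb1)
  have "0 \<le> n * (lam * (f1 r / r))"
    using q lam n_pos by (intro mult_nonneg_nonneg) auto
  with main have "min (lam * f2 r) (Lam * f2 r) < 0"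
    by linarith
  then show neg: "f2 r < 0"
    using lam Lam by (smt (verit) mult_nonneg_nonneg)
  have "Lam * f2 r \<le> lam * f2 r"
    using neg Lam by (simp add: mult_right_mono_neg)
  then have "Lam * f2 r + (lam * n) * (f1 r / r) < 0"
    using main by (simp only: min_absorb2 mult.assoc mult.left_commute[of lam])
  moreover have "Lam * (f1 r / r) \<le> (lam * n) * (f1 r / r)"
    using q n by (intro mult_right_mono) auto
  ultimately have "Lam * (f2 r + f1 r / r) < 0"
    by (simp add: algebra_simps)
  then have "f2 r + f1 r / r < 0"
    using lam Lam by (simp add: mult_less_0_iff)
  then have "r * (f2 r + f1 r / r) < 0"
    using r by (simp add: mult_less_0_iff)
  then show "f1 r + r * f2 r \<le> 0"
    using r by (simp add: distrib_left)
qed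

text \<open>At a maximum point z of f' on [r, s] the value is nonnegative, hence f''(z) < 0 and f'
  is larger just to the left of z. This is possible only if z is the left endpoint.\<close>

lemma f1_nonneg_left:
  assumes "0 < r" "r \<le> s" "s < 1" "0 \<le> f1 s"
  shows "0 \<le> f1 r"
proof -
  have "continuous_on {r..s} f1"
    using assms f2 by (intro DERIV_continuous_on[of _ _ f2])
      (auto intro: has_field_derivative_at_within)
  then obtain z where z: "z \<in> {r..s}" and max: "\<And>y. y \<in> {r..s} \<Longrightarrow> f1 y \<le> f1 z"
    using continuous_attains_sup[of "{r..s}" f1] assms by auto
  have z01: "0 < z" "z < 1"
    using z assms by auto
  have "0 \<le> f1 z"
    using max[of s] assms by simp
  then have "f2 z < 0"
    using concave_where_nondecreasing(1) z01 by blast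
  then obtain d where "0 < d" and d: "\<And>h. 0 < h \<Longrightarrow> h < d \<Longrightarrow> f1 z < f1 (z - h)"
    using DERIV_neg_dec_left[OF f2[OF z01]] by blast
  have "z = r"
  proof (rule ccontr)
    assume "z \<noteq> r"
    define h where "h = min (d / 2) (z - r)"
    have "0 < h" "h < d" "z - h \<in> {r..s}"
      using \<open>0 < d\<close> \<open>z \<noteq> r\<close> z by (auto simp: h_def min_def)
    with d[of h] max[of "z - h"] show False
      by simp
  qed
  then show ?thesis
    using \<open>0 \<le> f1 z\<close> by simp
qed

text \<open>Otherwise r f' stays above a positive constant c near 0, and integrating f' \<ge> c/r
  bounds f by a logarithm that tends to minus infinity at 0.\<close>

lemma f1_neg:
  assumes s: "0 < s" "s < 1"
  shows "f1 s < 0"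
proof (rule ccontr)
  assume "\<not> f1 s < 0"
  then have nonneg: "0 \<le> f1 r" if "0 < r" "r \<le> s" for r
    using f1_nonneg_left[of r s] that s by simp
  \<comment> \<open>Since f'(s) may vanish, a point strictly to the left of s is taken; strict
    decrease of f' makes its value there positive.\<close>
  define r1 where "r1 = s / 2"
  have r1: "0 < r1" "r1 < s" "r1 < 1"
    using s by (auto simp: r1_def)
  have "f1 s < f1 r1"
  proof (rule DERIV_neg_imp_decreasing[OF \<open>r1 < s\<close>])
    fix x assume "r1 \<le> x" "x \<le> s"
    with r1 s nonneg[of x] show "\<exists>y. (f1 has_real_derivative y) (at x) \<and> y < 0"
      by (intro exI[of _ "f2 x"] conjI f2 concave_where_nondecreasing(1)) auto
  qed
  with nonneg[of s] s have "0 < f1 r1"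
    by simp
  define c where "c = r1 * f1 r1"
  have "0 < c"
    using \<open>0 < f1 r1\<close> r1 by (simp add: c_def)
  have lower: "c / r \<le> f1 r" if "0 < r" "r \<le> r1" for r
  proof -
    have "r1 * f1 r1 \<le> r * f1 r"
    proof (rule le_of_deriv_nonpos[OF \<open>r \<le> r1\<close>])
      fix x assume "r \<le> x" "x \<le> r1"
      then have x: "0 < x" "x < 1" "x \<le> s"
        using that r1 by auto
      show "((\<lambda>x. x * f1 x) has_real_derivative f1 x + x * f2 x) (at x)"
        using DERIV_mult[OF DERIV_ident f2[OF x(1,2)]] by (simp add: mult.commute)
      show "f1 x + x * f2 x \<le> 0"
        using concave_where_nondecreasing(2) nonneg x by blast
    qed
    with that show ?thesis
      by (simp add: c_def field_simps)
  qed
  \<comment> \<open>The zero of the logarithmic upper bound f(r1) + c ln(r/r1).\<close>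
  define r where "r = r1 * exp (- f r1 / c)"
  have r: "0 < r" "r \<le> r1"
    using r1 \<open>0 < c\<close> f_pos[of r1] by (auto simp: r_def mult_le_cancel_left2)
  have ln_r: "ln r = ln r1 - f r1 / c"
    using r1 by (simp add: r_def ln_mult)
  have "c * ln r1 - f r1 \<le> c * ln r - f r"
  proof (rule le_of_deriv_nonpos[OF \<open>r \<le> r1\<close>])
    fix x assume "r \<le> x" "x \<le> r1"
    then have x: "0 < x" "x < 1" "x \<le> r1"
      using r r1 by auto
    show "((\<lambda>x. c * ln x - f x) has_real_derivative c / x - f1 x) (at x)"
      using x f1[OF x(1,2)] by (auto intro!: derivative_eq_intros)
    show "c / x - f1 x \<le> 0"
      using lower x by simp
  qed
  then have "f r \<le> 0"
    using \<open>0 < c\<close> by (simp add: ln_r right_diff_distrib)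
  with f_pos[of r] r r1 show False
    by simp
qed

text \<open>Since f' < 0, the tangential minimum has coefficient \<open>Lam\<close>. The sign of f''
  is unknown, so one divides by \<open>lam\<close> if f'' \<ge> 0 and by \<open>Lam\<close>
  otherwise. The stated coefficients are the weaker ones in either case: 1/\<open>lam\<close> on the
  negative tangential term and 1/\<open>Lam\<close> on the positive potential.\<close>

lemma f2_upper:
  assumes r: "0 < r" "r < 1"
  shows "f2 r + Lam * n / lam * (f1 r / r) + \<mu> / Lam * (f r / r powr \<gamma>) \<le> 0"
proof -
  define q where "q = f1 r / r"
  define p where "p = \<mu> * (f r / r powr \<gamma>)"
  have q: "q < 0"
    using f1_neg[OF r] r by (simp add: q_def divide_neg_pos)
  have p: "0 < p"
    using potential_pos[OF r] by (simp add: p_def)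
  have Lam_pos: "0 < Lam"
    using lam Lam by simp
  have "Lam * q \<le> lam * q"
    using q Lam by (simp add: mult_right_mono_neg)
  then have main: "min (lam * f2 r) (Lam * f2 r) + n * (Lam * q) + p \<le> 0"
    using super[OF r] unfolding p_def[symmetric] q_def[symmetric] by (simp only: min_absorb2)
  have nq: "n * (Lam * q) < 0"
    using q n_pos Lam_pos by (simp add: mult_pos_neg)
  have "f2 r + n * (Lam * q) / lam + p / Lam \<le> 0"
  proof (cases "0 \<le> f2 r")
    case True
    then have "lam * f2 r + n * (Lam * q) + p \<le> 0"
      using main mult_right_mono[OF Lam True] by (simp only: min_absorb1)
    then have "(lam * f2 r + n * (Lam * q) + p) / lam \<le> 0"
      using lam by (simp add: divide_le_0_iff)
    moreover have "p / Lam \<le> p / lam"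
      using p lam Lam by (simp add: frac_le)
    ultimately show ?thesis
      using lam by (simp add: add_divide_distrib)
  next
    case False
    then have "Lam * f2 r + n * (Lam * q) + p \<le> 0"
      using main mult_right_mono_neg[OF Lam, of "f2 r"] by (simp only: min_absorb2 not_le less_imp_le)
    then have "(Lam * f2 r + n * (Lam * q) + p) / Lam \<le> 0"
      using Lam_pos by (simp add: divide_le_0_iff)
    moreover have "n * (Lam * q) / lam \<le> n * (Lam * q) / Lam"
      using nq lam Lam Lam_pos by (intro divide_left_mono_neg) auto
    ultimately show ?thesis
      using Lam_pos by (simp add: add_divide_distrib)
  qed
  then show ?thesis
    by (simp add: p_def q_def field_simps)
qed

lemma no_positive_solution: False
proof -
  define K where "K = Lam * n / lam"
  define m where "m = \<mu> / Lam"
  have "0 < m"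
    using \<mu> lam Lam by (simp add: m_def)
  \<comment> \<open>The second entry lets the potential absorb the remainder from completing the
    square in w and leave -1. The entry 2 keeps the base above 1, so that its negative power
    \<open>r1\<close> is below 1.\<close>
  define C where "C = max 2 ((1 + ((K - 1) / 2)\<^sup>2) / m)"
  define r1 where "r1 = C powr (1 / (2 - \<gamma>))"
  have C: "2 \<le> C" "1 + ((K - 1) / 2)\<^sup>2 \<le> m * C"
    using \<open>0 < m\<close> by (auto simp: C_def max_def field_simps)
  have "C powr (1 / (2 - \<gamma>)) < C powr 0"
    using C \<gamma> by (intro powr_less_mono) (auto simp: field_simps)
  then have r1: "0 < r1" "r1 < 1"
    using C by (auto simp: r1_def)
  have large: "1 + ((K - 1) / 2)\<^sup>2 \<le> m * r powr (2 - \<gamma>)" if "0 < r" "r \<le> r1" for r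
  proof -
    have "C = r1 powr (2 - \<gamma>)"
      using C \<gamma> by (simp add: r1_def powr_powr)
    also have "\<dots> \<le> r powr (2 - \<gamma>)"
      using that \<gamma> by (intro powr_mono2') auto
    finally show ?thesis
      using C \<open>0 < m\<close> mult_left_mono[of C "r powr (2 - \<gamma>)" m] by linarith
  qed
  \<comment> \<open>This is the derivative of ln f with respect to ln r.\<close>
  define w where "w = (\<lambda>r. r * f1 r / f r)"
  define w' where "w' = (\<lambda>r. ((f1 r + r * f2 r) * f r - r * f1 r * f1 r) / (f r * f r))"
  have w': "(w has_real_derivative w' r) (at r)" if "0 < r" "r < 1" for r
    using DERIV_divide[OF DERIV_mult[OF DERIV_ident f2[OF that]] f1[OF that]] f_pos[OF that]
    by (simp add: w_def w'_def mult.commute[of "f2 r"])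
  have decay: "w' r + 1 / r \<le> 0" if r: "0 < r" "r \<le> r1" for r
  proof -
    have r': "0 < r" "r < 1"
      using r r1 by auto
    have fr: "0 < f r"
      using f_pos r' by blast
    \<comment> \<open>Scaling by r^2/f makes the inequality one in w alone, apart from r^2 f''/f,
      which the formula for r w' eliminates. The potential becomes m r^(2 - \<gamma>), unbounded at
      0.\<close>
    have "r\<^sup>2 / f r * (f2 r + K * (f1 r / r) + m * (f r / r powr \<gamma>)) \<le> 0"
      using f2_upper[OF r'] r' fr by (intro mult_nonneg_nonpos) (auto simp: K_def m_def)
    moreover have "r\<^sup>2 / f r * (f2 r + K * (f1 r / r) + m * (f r / r powr \<gamma>))
        = r\<^sup>2 * f2 r / f r + K * w r + m * r powr (2 - \<gamma>)"
      using r' fr by (simp add: w_def powr_diff field_simps power2_eq_square)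
    ultimately have "r\<^sup>2 * f2 r / f r + K * w r + m * r powr (2 - \<gamma>) \<le> 0"
      by simp
    moreover have "r * w' r = w r + r\<^sup>2 * f2 r / f r - (w r)\<^sup>2"
      using r' fr by (simp add: w_def w'_def field_simps power2_eq_square)
    ultimately have "r * w' r \<le> - (w r)\<^sup>2 - (K - 1) * w r - m * r powr (2 - \<gamma>)"
      by (simp add: algebra_simps)
    also have "\<dots> \<le> - (w r)\<^sup>2 - (K - 1) * w r - (1 + ((K - 1) / 2)\<^sup>2)"
      using large[OF r] by simp
    also have "\<dots> = - 1 - (w r + (K - 1) / 2)\<^sup>2"
      by (simp add: power2_eq_square field_simps)
    also have "\<dots> \<le> - 1"
      by simp
    finally show ?thesis
      using r' by (simp add: field_simps)
  qed
  have w_neg: "w r < 0" if "0 < r" "r < 1" for r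
    using f1_neg[OF that] f_pos[OF that] that
    by (simp add: w_def divide_neg_pos mult_pos_neg)
  \<comment> \<open>Chosen so that ln r = ln \<open>r1\<close> + w(\<open>r1\<close>). As w + ln is
    nonincreasing on (0, \<open>r1\<close>], this forces w(r) \<ge> 0.\<close>
  define r where "r = r1 * exp (w r1)"
  have r: "0 < r" "r \<le> r1"
    using r1 w_neg[of r1] by (auto simp: r_def mult_le_cancel_left2)
  have "w r1 + ln r1 \<le> w r + ln r"
  proof (rule le_of_deriv_nonpos[OF \<open>r \<le> r1\<close>])
    fix x assume "r \<le> x" "x \<le> r1"
    then have x: "0 < x" "x < 1" "x \<le> r1"
      using r r1 by auto
    show "((\<lambda>x. w x + ln x) has_real_derivative w' x + 1 / x) (at x)"
      using x w'[OF x(1,2)] by (auto intro!: derivative_eq_intros)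
    show "w' x + 1 / x \<le> 0"
      using decay x by blast
  qed
  moreover have "ln r = ln r1 + w r1"
    using r1 by (simp add: r_def ln_mult)
  ultimately have "0 \<le> w r"
    by simp
  with w_neg[of r] r r1 show False
    by simp
qed

end

section \<open>Diagonal matrices and the lower Pucci bound\<close>

definition diag_matrix :: "('n \<Rightarrow> real) \<Rightarrow> real ^ 'n ^ 'n"
  where "diag_matrix d = (\<chi> i j. if i = j then d i else 0)"

lemma diag_matrix_symmetric: "diag_matrix d \<in> symmetric_matrices"
  by (auto simp: symmetric_matrices_def diag_matrix_def transpose_def vec_eq_iff)

lemma diag_matrix_mult_vec: "diag_matrix d *v x = (\<chi> i. d i * x $ i)"
  by (simp add: diag_matrix_def matrix_vector_mult_def vec_eq_iff if_distrib[of "\<lambda>t. t * _"]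
      cong: if_cong)

lemma diag_matrix_psd:
  assumes "\<And>i. 0 \<le> d i"
  shows "psd_matrix (diag_matrix d)"
proof -
  have "0 \<le> x \<bullet> (diag_matrix d *v x)" for x
    unfolding diag_matrix_mult_vec inner_vec_def
    using assms by (auto intro!: sum_nonneg simp: mult.left_commute[of _ "d _"])
  then show ?thesis
    using diag_matrix_symmetric[of d] by (simp add: psd_matrix_def symmetric_matrices_def)
qed

lemma diag_matrix_add: "diag_matrix d + diag_matrix e = diag_matrix (\<lambda>i. d i + e i)"
  by (simp add: diag_matrix_def vec_eq_iff)

lemma trace_diag_matrix: "trace (diag_matrix d) = sum d UNIV"
  by (simp add: trace_def diag_matrix_def)

text \<open>Homogeneity is given for t > 0 only, so t = 2 is used at the zero matrix.\<close>

lemma positively_homogeneous_zero: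
  assumes "positively_homogeneous F"
  shows "F 0 = 0"
proof -
  have "(0 :: real ^ 'n ^ 'n) \<in> symmetric_matrices"
    by (simp add: symmetric_matrices_def transpose_def vec_eq_iff)
  then have "F (2 *\<^sub>R 0) = 2 * F 0"
    using assms unfolding positively_homogeneous_def by (meson zero_less_numeral)
  then show ?thesis
    by simp
qed

text \<open>Write d = p - m with positive part p and negative part m, and apply ellipticity twice
  from the matrix of -m. Adding m reaches 0, so F(-m) \<ge> -Lam tr m; adding p reaches d and gains
  at least lam tr p. The sum on the left is the minimal Pucci operator.\<close>

lemma uniformly_elliptic_diag_lower:
  fixes d :: "'n::finite \<Rightarrow> real"
  assumes "uniformly_elliptic lam Lam F" "F 0 = 0" "lam \<le> Lam"
  shows "(\<Sum>i\<in>UNIV. min (lam * d i) (Lam * d i)) \<le> F (diag_matrix d)"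
proof -
  define p where "p = (\<lambda>i. max (d i) 0)"
  define m where "m = (\<lambda>i. max (- d i) 0)"
  have zero: "diag_matrix (\<lambda>i. - m i) + diag_matrix m = 0"
    by (simp add: diag_matrix_add diag_matrix_def vec_eq_iff)
  have d: "diag_matrix (\<lambda>i. - m i) + diag_matrix p = diag_matrix d"
    unfolding diag_matrix_add
    by (rule arg_cong[of _ _ diag_matrix]) (auto simp: m_def p_def max_def)
  have ell: "lam * sum e UNIV \<le> F (diag_matrix (\<lambda>i. - m i) + diag_matrix e) - F (diag_matrix (\<lambda>i. - m i))"
    "F (diag_matrix (\<lambda>i. - m i) + diag_matrix e) - F (diag_matrix (\<lambda>i. - m i)) \<le> Lam * sum e UNIV"
    if "\<And>i. 0 \<le> e i" for e
    using assms(1) diag_matrix_psd[of e] diag_matrix_symmetric that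
    unfolding uniformly_elliptic_def trace_diag_matrix[symmetric] by blast+
  have "(\<Sum>i\<in>UNIV. min (lam * d i) (Lam * d i)) = (\<Sum>i\<in>UNIV. lam * p i - Lam * m i)"
  proof (rule sum.cong)
    fix i
    show "min (lam * d i) (Lam * d i) = lam * p i - Lam * m i"
      using mult_right_mono[OF assms(3), of "d i"] mult_right_mono_neg[OF assms(3), of "d i"]
      by (auto simp: p_def m_def min_def max_def)
  qed simp
  also have "\<dots> = lam * sum p UNIV - Lam * sum m UNIV"
    by (simp add: sum_subtractf sum_distrib_left)
  also have "\<dots> \<le> F (diag_matrix d)"
    using ell(1)[of p] ell(2)[of m] assms(2) by (simp add: zero d) (simp add: p_def m_def)
  finally show ?thesis .
qed

section \<open>Gradient and Hessian of radial functions\<close>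

lemma open_punctured_ball: "open punctured_ball"
  by (simp add: punctured_ball_def open_delete)

lemma differentiable_imp_gderiv:
  assumes "u differentiable at x"
  shows "GDERIV u x :> gradient u x"
proof -
  from assms obtain D where D: "(u has_derivative D) (at x)"
    by (auto simp: differentiable_def)
  \<comment> \<open>The adjoint at 1 is the vector that represents the linear functional D.\<close>
  have "D = (\<lambda>h. h \<bullet> adjoint D 1)"
    using adjoint_works[OF has_derivative_linear[OF D], of _ 1] by (simp add: fun_eq_iff)
  with D have "GDERIV u x :> adjoint D 1"
    by (simp add: gderiv_def)
  then show ?thesis
    by (simp add: gradient_eqI)
qed

text \<open>The Hessian of a radial function at a point of the k-th positive half-axis:
  \<open>a\<close> is the radial eigenvalue f'', \<open>b\<close> the tangential one f'/r.\<close>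

definition radial_hessian :: "real \<Rightarrow> real \<Rightarrow> 'n \<Rightarrow> real ^ 'n ^ 'n"
  where "radial_hessian a b k = diag_matrix (\<lambda>i. if i = k then a else b)"

text \<open>The profile is read off as r \<mapsto> u(r e), because the function supplied by
  \<open>radial_on\<close> comes without any regularity. Taking e as a coordinate vector makes the
  Hessian on this ray diagonal.\<close>

context
  fixes u :: "real ^ 'n \<Rightarrow> real" and k :: 'n and e :: "real ^ 'n"
  assumes C2: "C2_on punctured_ball u" and radial: "radial_on punctured_ball u"
  defines "e \<equiv> axis k 1"
begin

lemma norm_e: "norm e = 1"
  by (simp add: e_def)

lemma ray_in_punctured_ball: "0 < r \<Longrightarrow> r < 1 \<Longrightarrow> r *\<^sub>R e \<in> punctured_ball"
  using norm_e by (auto simp: punctured_ball_def)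

lemma norm_punctured_ball: "x \<in> punctured_ball \<Longrightarrow> 0 < norm x \<and> norm x < 1"
  by (auto simp: punctured_ball_def)

lemma profile_deriv:
  assumes "0 < r" "r < 1"
  shows "((\<lambda>r. u (r *\<^sub>R e)) has_real_derivative gradient u (r *\<^sub>R e) \<bullet> e) (at r)"
proof -
  have "(u has_derivative (\<lambda>h. h \<bullet> gradient u (r *\<^sub>R e))) (at (r *\<^sub>R e))"
    using C2 ray_in_punctured_ball[OF assms] differentiable_imp_gderiv
    by (auto simp: C2_on_def gderiv_def)
  moreover have "((\<lambda>r. r *\<^sub>R e) has_derivative (\<lambda>h. h *\<^sub>R e)) (at r)"
    by (auto intro!: derivative_eq_intros)
  ultimately have "((\<lambda>r. u (r *\<^sub>R e)) has_derivative (\<lambda>h. h *\<^sub>R e \<bullet> gradient u (r *\<^sub>R e))) (at r)"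
    by (rule has_derivative_compose[rotated])
  then show ?thesis
    by (simp add: has_field_derivative_def inner_commute mult.commute[of _ "_ \<bullet> _"])
qed

lemma profile_second_deriv:
  assumes "0 < r" "r < 1"
  obtains c where "((\<lambda>r. gradient u (r *\<^sub>R e) \<bullet> e) has_real_derivative c) (at r)"
proof -
  from C2 ray_in_punctured_ball[OF assms] have "gradient u differentiable at (r *\<^sub>R e)"
    by (simp add: C2_on_def)
  then have "(\<lambda>r. gradient u (r *\<^sub>R e)) differentiable at r"
    using differentiable_compose[of "gradient u" "\<lambda>r. r *\<^sub>R e" r UNIV] by simp
  then have "(\<lambda>r. gradient u (r *\<^sub>R e) \<bullet> e) differentiable at r"
    by simp
  with that show thesis
    by (auto simp: real_differentiable_def)
qed

lemma radial_profile: "x \<in> punctured_ball \<Longrightarrow> u x = u (norm x *\<^sub>R e)"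
  using radial norm_punctured_ball[of x] ray_in_punctured_ball[of "norm x"] norm_e
  by (auto simp: radial_on_def)

text \<open>Chain rule for the profile composed with the norm, whose derivative at x is the inner
  product with \<open>sgn x\<close>. The composition equals u on an open set around x, which
  suffices for the derivative.\<close>

lemma radial_gradient:
  assumes x: "x \<in> punctured_ball"
  shows "gradient u x = ((gradient u (norm x *\<^sub>R e) \<bullet> e) / norm x) *\<^sub>R x"
proof (rule gradient_eqI)
  define p where "p = gradient u (norm x *\<^sub>R e) \<bullet> e"
  have nx: "0 < norm x" "norm x < 1"
    using norm_punctured_ball[OF x] by auto
  have "((\<lambda>r. u (r *\<^sub>R e)) has_derivative (\<lambda>h. p * h)) (at (norm x))"
    using profile_deriv[OF nx] by (simp add: has_field_derivative_def p_def)
  moreover have "(norm has_derivative (\<lambda>h. h \<bullet> sgn x)) (at x)"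
    using has_derivative_norm nx by auto
  ultimately have "((\<lambda>x. u (norm x *\<^sub>R e)) has_derivative (\<lambda>h. p * (h \<bullet> sgn x))) (at x)"
    by (rule has_derivative_compose[rotated])
  then have "(u has_derivative (\<lambda>h. p * (h \<bullet> sgn x))) (at x)"
    by (rule has_derivative_transform_within_open[OF _ open_punctured_ball x])
      (simp add: radial_profile)
  then show "GDERIV u x :> (p / norm x) *\<^sub>R x"
    by (simp add: gderiv_def sgn_div_norm divide_inverse mult.assoc)
qed

text \<open>With p = f', the gradient is (p(|x|)/|x|) x near the point, and the product rule gives
  p/r times the identity plus q r times the projection onto e, where q = (p/r)'. The radial entry is
  p/r + q r = c.\<close>

lemma hessian_radial:
  assumes r: "0 < r" "r < 1"
    and c: "((\<lambda>r. gradient u (r *\<^sub>R e) \<bullet> e) has_real_derivative c) (at r)"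
  shows "hessian u (r *\<^sub>R e) = radial_hessian c ((gradient u (r *\<^sub>R e) \<bullet> e) / r) k"
proof (rule hessian_eqI)
  define p where "p = (\<lambda>r. gradient u (r *\<^sub>R e) \<bullet> e)"
  define x where "x = r *\<^sub>R e"
  have x: "x \<in> punctured_ball" "norm x = r" "sgn x = e"
    using ray_in_punctured_ball[OF r] r norm_e by (auto simp: x_def sgn_div_norm)
  define q where "q = (c * r - p r) / (r * r)"
  have "((\<lambda>r. p r / r) has_derivative (\<lambda>h. q * h)) (at (norm x))"
    using c r unfolding x(2) has_field_derivative_def[symmetric] p_def q_def
    by (auto intro!: derivative_eq_intros)
  moreover have "(norm has_derivative (\<lambda>h. h \<bullet> e)) (at x)"
    using has_derivative_norm[of x] x r by auto
  ultimately have "((\<lambda>x. p (norm x) / norm x) has_derivative (\<lambda>h. q * (h \<bullet> e))) (at x)"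
    by (rule has_derivative_compose[rotated])
  from has_derivative_scaleR[OF this has_derivative_ident]
  have "((\<lambda>x. (p (norm x) / norm x) *\<^sub>R x) has_derivative
      (\<lambda>h. (p r / r) *\<^sub>R h + (q * (h \<bullet> e)) *\<^sub>R x)) (at x)"
    by (simp add: x(2))
  moreover have "(\<lambda>h. (p r / r) *\<^sub>R h + (q * (h \<bullet> e)) *\<^sub>R x) = (*v) (radial_hessian c (p r / r) k)"
  proof
    fix h
    have "((p r / r) *\<^sub>R h + (q * (h \<bullet> e)) *\<^sub>R x) $ i = (radial_hessian c (p r / r) k *v h) $ i" for i
      using r by (simp add: radial_hessian_def diag_matrix_mult_vec x_def e_def inner_axis q_def)
        (simp add: axis_def field_simps)
    then show "(p r / r) *\<^sub>R h + (q * (h \<bullet> e)) *\<^sub>R x = radial_hessian c (p r / r) k *v h"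
      unfolding vec_eq_iff by blast
  qed
  ultimately have "((\<lambda>x. (p (norm x) / norm x) *\<^sub>R x) has_derivative
      (*v) (radial_hessian c (p r / r) k)) (at x)"
    by simp
  then have "(gradient u has_derivative (*v) (radial_hessian c (p r / r) k)) (at x)"
    by (rule has_derivative_transform_within_open[OF _ open_punctured_ball x(1)])
      (simp add: radial_gradient p_def)
  then show "(gradient u has_derivative
      (*v) (radial_hessian c ((gradient u (r *\<^sub>R e) \<bullet> e) / r) k)) (at (r *\<^sub>R e))"
    by (simp add: x_def p_def)
qed

end

section \<open>Reduction to the profile and value of the supremum\<close>

lemma no_positive_radial_supersolution:
  fixes F :: "real ^ 'n ^ 'n \<Rightarrow> real"
  assumes lam: "0 < lam" "lam \<le> Lam"
    and ell: "uniformly_elliptic lam Lam F" and hom: "positively_homogeneous F"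
    and N: "N_tilde_plus lam Lam CARD('n) > 2"
    and \<gamma>: "\<gamma> > 2" and \<mu>: "\<mu> > 0"
  shows "\<not> positive_radial_supersolution F \<gamma> \<mu> u"
proof
  assume u: "positive_radial_supersolution F \<gamma> \<mu> u"
  then have C2: "C2_on punctured_ball u" and radial: "radial_on punctured_ball u"
    by (auto simp: positive_radial_supersolution_def)
  fix k :: 'n
  define e :: "real ^ 'n" where "e = axis k 1"
  note ray = ray_in_punctured_ball[OF C2 radial, where k = k, folded e_def]
  define f where "f = (\<lambda>r. u (r *\<^sub>R e))"
  define f1 where "f1 = (\<lambda>r. gradient u (r *\<^sub>R e) \<bullet> e)"
  \<comment> \<open>The second derivative is known to exist only pointwise on (0, 1), so choice
    assembles it into a function.\<close>
  define f2 where "f2 = (\<lambda>r. SOME c. (f1 has_real_derivative c) (at r))"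
  define n where "n = real CARD('n) - 1"
  have f2: "(f1 has_real_derivative f2 r) (at r)" if r: "0 < r" "r < 1" for r
  proof -
    obtain c where "(f1 has_real_derivative c) (at r)"
      using profile_second_deriv[OF C2 radial r, where k = k] unfolding f1_def e_def by blast
    then show ?thesis
      unfolding f2_def by (rule someI)
  qed
  show False
  proof (rule no_positive_solution[of lam Lam n \<gamma> \<mu> f f1 f2])
    show "Lam < lam * n"
      using N lam by (simp add: N_tilde_plus_def n_def field_simps)
    fix r :: real assume r: "0 < r" "r < 1"
    show "(f has_real_derivative f1 r) (at r)"
      using profile_deriv[OF C2 radial r, where k = k] by (simp add: f_def f1_def e_def)
    show "(f1 has_real_derivative f2 r) (at r)"
      using f2 r by blast
    show "0 < f r"
      using u ray[OF r] by (simp add: f_def positive_radial_supersolution_def)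
    have "hessian u (r *\<^sub>R e) = radial_hessian (f2 r) (f1 r / r) k"
      using hessian_radial[OF C2 radial r, where k = k and c = "f2 r", folded e_def] f2[OF r]
      by (simp add: f1_def)
    moreover have "norm (r *\<^sub>R e) = r"
      using r by (simp add: e_def)
    moreover have "F (hessian u (r *\<^sub>R e)) + \<mu> * (f r / norm (r *\<^sub>R e) powr \<gamma>) \<le> 0"
      using u ray[OF r] unfolding positive_radial_supersolution_def f_def by blast
    ultimately have sup: "F (radial_hessian (f2 r) (f1 r / r) k) + \<mu> * (f r / r powr \<gamma>) \<le> 0"
      by (simp only:)
    define g where "g = (\<lambda>s. min (lam * s) (Lam * s))"
    \<comment> \<open>The index k carries the radial eigenvalue; the remaining N - 1 indices share
      the tangential one.\<close>
    have "g (f2 r) + n * g (f1 r / r) = (\<Sum>i\<in>UNIV. g (if i = k then f2 r else f1 r / r))"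
      by (subst sum.remove[of UNIV k]) (simp_all add: n_def card_Diff_singleton of_nat_diff Suc_le_eq)
    also have "\<dots> \<le> F (radial_hessian (f2 r) (f1 r / r) k)"
      unfolding g_def radial_hessian_def
      by (rule uniformly_elliptic_diag_lower[OF ell positively_homogeneous_zero[OF hom] lam(2)])
    finally show "min (lam * f2 r) (Lam * f2 r) + n * min (lam * (f1 r / r)) (Lam * (f1 r / r))
        + \<mu> * (f r / r powr \<gamma>) \<le> 0"
      using sup by (simp add: g_def)
  qed (use lam \<gamma> \<mu> in auto)
qed

text \<open>The Hessian of a constant is 0 and F(0) = 0. This puts 0 in the set of admissible \<mu>
  and gives the lower bound for the supremum.\<close>

lemma constant_supersolution:
  assumes "positively_homogeneous F"
  shows "positive_radial_supersolution F \<gamma> 0 (\<lambda>_. 1)"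
proof -
  have grad: "gradient (\<lambda>_. 1 :: real) = (\<lambda>_ :: real ^ 'n. 0)"
    by (rule ext, rule gradient_eqI) (simp add: gderiv_def)
  have hess: "hessian (\<lambda>_ :: real ^ 'n. 1) = (\<lambda>_. 0)"
  proof
    fix x :: "real ^ 'n"
    have "(*v) 0 = (\<lambda>_ :: real ^ 'n. 0 :: real ^ 'n)"
      by (simp add: fun_eq_iff matrix_vector_mult_def vec_eq_iff)
    then show "hessian (\<lambda>_. 1) x = 0"
      by (intro hessian_eqI) (simp add: grad)
  qed
  show ?thesis
    by (auto simp: positive_radial_supersolution_def C2_on_def radial_on_def grad hess
        positively_homogeneous_zero[OF assms])
qed

theorem theorem1p3:
  fixes F :: "real ^ 'n ^ 'n \<Rightarrow> real" and lam Lam \<gamma> :: real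
  assumes "0 < lam" and "lam \<le> Lam"
    and "continuous_on symmetric_matrices F"
    and "uniformly_elliptic lam Lam F"
    and "rotation_invariant F"
    and "positively_homogeneous F"
    and "N_tilde_plus lam Lam CARD('n) > 2"
    and "\<gamma> > 2"
  shows "lambda_bar' F \<gamma> = 0"
  unfolding lambda_bar'_def
proof (rule Sup_eqI)
  fix y assume "y \<in> {ereal \<mu> |\<mu>. \<exists>u. positive_radial_supersolution F \<gamma> \<mu> u}"
  then obtain \<mu> u where "y = ereal \<mu>" "positive_radial_supersolution F \<gamma> \<mu> u"
    by blast
  with no_positive_radial_supersolution[OF assms(1,2,4,6,7,8), of \<mu> u] show "y \<le> 0"
    by fastforce
next
  fix y :: ereal
  assume "\<And>z. z \<in> {ereal \<mu> |\<mu>. \<exists>u. positive_radial_supersolution F \<gamma> \<mu> u} \<Longrightarrow> z \<le> y"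
  moreover have "ereal 0 \<in> {ereal \<mu> |\<mu>. \<exists>u. positive_radial_supersolution F \<gamma> \<mu> u}"
    using constant_supersolution[OF assms(6)] by blast
  ultimately have "ereal 0 \<le> y"
    by blast
  then show "0 \<le> y"
    by (simp add: zero_ereal_def)
qed

end
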